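(* Let $n \geq 4$ be an integer. Then a universal cycle on $3$-multisets of $[n]=\{1,\ldots,n\}$ exists if and only if $n$ divides $\binom{n+2}{3}$.
   Context: A $3$-multiset over $[n]$ is a multiset of size $3$ (counted with multiplicity; repetitions allowed, order irrelevant) with elements in $[n]=\{1,\ldots,n\}$; there are $\binom{n+2}{3}$ of them. A universal cycle on $3$-multisets of $[n]$ is a cyclic string $X=a_1a_2\cdots a_k$ with each $a_i\in[n]$ such that, with indices taken cyclically modulo $k$, the windows $\{a_i,a_{i+1},a_{i+2}\}$, $i=1,\ldots,k$, regarded as multisets, run through every $3$-multiset over $[n]$ exactly once (so necessarily $k=\binom{n+2}{3}$). *)

theory Defs
  imports Complex_Main "HOL-Library.Multiset"
begin

definition multisets3 :: "nat \<Rightarrow> nat multiset set" where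
  "multisets3 n = {M. size M = 3 \<and> set_mset M \<subseteq> {1..n}}"

(* A cyclic string is represented by a list, read with 0-based indices modulo its length. *)
definition window3 :: "nat list \<Rightarrow> nat \<Rightarrow> nat multiset" where
  "window3 X i = {# X ! (i mod length X), X ! ((i + 1) mod length X), X ! ((i + 2) mod length X) #}"

definition universal_cycle3 :: "nat \<Rightarrow> nat list \<Rightarrow> bool" where
  "universal_cycle3 n X \<longleftrightarrow>
     set X \<subseteq> {1..n} \<and>
     (\<forall>M \<in> multisets3 n. \<exists>!i. i < length X \<and> window3 X i = M)"

end

theory Submission
  imports Defs "Graph_Theory.Euler" "HOL-Combinatorics.Transposition"
begin

text \<open>
  Necessity is double counting. Each occurrence of a letter lies in three windows, and by
  symmetry all letters have the same total multiplicity in the 3-multisets; so the number of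
  3-multisets is \<open>n\<close> times the number of occurrences of any one letter.

  For sufficiency, \<open>n\<close> dividing the binomial coefficient means that 3 does not divide \<open>n\<close>. Read the
  letters as residues modulo \<open>n\<close>. Going once round the circle, a 3-multiset splits \<open>n\<close> into three
  gaps \<open>(x, y, z)\<close>, up to rotation, and any two cyclically consecutive gaps \<open>x, y\<close> give a way to write
  the multiset as a word \<open>a, a + x, a + x + y\<close>. A universal cycle has to choose one word for each
  multiset such that the chosen words can be chained. Here the choice depends only on the gaps: two
  equal gaps, or for distinct gaps the pair of the smallest and the largest one (the
  smallest and the middle one, if the smallest is 0). Since 3 does not divide \<open>n\<close>, the three gaps
  are never all equal, and the choice is unique (\<open>inj_on_gap_windows\<close>, \<open>gap_windows_cover\<close>).

  The chosen words are the arcs of a digraph whose vertices are the pairs of adjacent letters, and an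
  Eulerian circuit of it is a universal cycle (\<open>eulerian_window_sequence\<close>). The choice of two gaps
  is unordered, so in-degrees equal out-degrees (\<open>gap_windows_balanced\<close>). For connectedness
  (\<open>gap_windows_connected\<close>), the words \<open>a, a + 1, a + 2\<close> link all pairs \<open>(a, a + 1)\<close>; the gap 0 is
  chosen together with every positive gap below \<open>n/2\<close>, and every larger gap in use is chosen together with
  one below \<open>n/2\<close>. The gap \<open>n/2\<close> needs the partition \<open>1 < n/2 - 1 < n/2\<close>, which fails for
  \<open>n = 4\<close>; that case has an explicit cycle.
\<close>

section \<open>Choosing one word for each 3-multiset\<close>

definition cyc_diff :: "nat \<Rightarrow> nat \<Rightarrow> nat \<Rightarrow> nat" where
  "cyc_diff n a b = (if a \<le> b then b - a else n + b - a)"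

text \<open>
  For three distinct gaps with sum \<open>n\<close>, this says that \<open>x\<close> is the least of them and \<open>z\<close> the one it is
  paired with; the third gap is \<open>n - x - z\<close>. If \<open>x = 0\<close> then \<open>z\<close> is the middle gap, otherwise the largest.
  The zero gap has to be treated apart: if it were paired with the largest gap, then the least gap above \<open>n/3\<close>
  would only be paired with itself, and the digraph would fall apart.
\<close>
definition joins_min :: "nat \<Rightarrow> nat \<Rightarrow> nat \<Rightarrow> bool" where
  "joins_min n x z \<longleftrightarrow> (x = 0 \<and> 0 < z \<and> 2 * z < n) \<or> (0 < x \<and> 2 * x + z < n \<and> n < x + 2 * z)"

definition gap_pair :: "nat \<Rightarrow> nat \<Rightarrow> nat \<Rightarrow> bool" where
  "gap_pair n x y \<longleftrightarrow> (x = y \<and> 2 * x \<le> n) \<or> joins_min n x y \<or> joins_min n y x"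

definition gap_windows :: "nat \<Rightarrow> (nat \<times> nat \<times> nat) set" where
  "gap_windows n = {(a, b, c). a < n \<and> b < n \<and> c < n
    \<and> gap_pair n (cyc_diff n a b) (cyc_diff n b c)}"

lemma gap_pair_sym: "gap_pair n x y \<Longrightarrow> gap_pair n y x" unfolding gap_pair_def by auto

text \<open>
  This inequality and the next one rule out words read against the direction of the circle.
\<close>
lemma gap_pair_zero: "gap_pair n 0 y \<Longrightarrow> 0 < n \<Longrightarrow> 2 * y < n"
  unfolding gap_pair_def joins_min_def by auto

lemma gap_pair_sum: "gap_pair n x y \<Longrightarrow> x + y < n \<or> (x = y \<and> 2 * x = n)"
  unfolding gap_pair_def joins_min_def by auto

lemma gap_pair_exists:
  assumes n: "x + y + z = n"
  shows "gap_pair n x y \<or> gap_pair n y z \<or> gap_pair n z x"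
proof (cases "x = y \<or> y = z \<or> z = x")
  case True
  moreover have "gap_pair n x y" if "x = y" using that n(1) unfolding gap_pair_def by simp
  moreover have "gap_pair n y z" if "y = z" using that n(1) unfolding gap_pair_def by simp
  moreover have "gap_pair n z x" if "z = x" using that n(1) unfolding gap_pair_def by simp
  ultimately show ?thesis by blast
next
  case False
  have key: "gap_pair n u v \<or> gap_pair n u w" if "u < v" "v < w" "u + v + w = n" for u v w
    using that unfolding gap_pair_def joins_min_def by (cases "u = 0") auto
  have "(x < y \<and> y < z) \<or> (x < z \<and> z < y) \<or> (y < x \<and> x < z) \<or> (y < z \<and> z < x) \<or> (z < x \<and> x < y)
    \<or> (z < y \<and> y < x)"
    using False by linarith
  moreover have "x + z + y = n" "y + x + z = n" "y + z + x = n" "z + x + y = n" "z + y + x = n"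
    using n(1) by auto
  ultimately show ?thesis using key n(1) gap_pair_sym by metis
qed

lemma cyc_diff_less: "a < n \<Longrightarrow> b < n \<Longrightarrow> cyc_diff n a b < n" unfolding cyc_diff_def by auto

lemma cyc_diff_0: "a < n \<Longrightarrow> b < n \<Longrightarrow> cyc_diff n a b = 0 \<longleftrightarrow> a = b" unfolding cyc_diff_def by auto

lemma cyc_diff_rev: "a < n \<Longrightarrow> b < n \<Longrightarrow> cyc_diff n b a = (if cyc_diff n a b = 0 then 0
  else n - cyc_diff n a b)"
  unfolding cyc_diff_def by auto

lemma cyc_diff_add:
  assumes "a < n" "b < n" "c < n"
  shows "cyc_diff n a c =
    (let s = cyc_diff n a b + cyc_diff n b c in if s < n then s else s - n)"
  using assms unfolding cyc_diff_def Let_def by auto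

text \<open>
  A word from \<open>gap_windows\<close> goes at most once round the circle, by \<open>gap_pair_sum\<close>. Exchanging two letters
  turns it into a word that goes against the direction of the circle, with two forward steps of total length
  at least \<open>n\<close>; equality is left to \<open>gap_pair_zero\<close>. This settles the three transpositions.
\<close>
lemma no_window_swap_front:
  assumes "a<n" "b<n" "c<n" "gap_pair n (cyc_diff n a b) (cyc_diff n b c)"
    "gap_pair n (cyc_diff n b a) (cyc_diff n a c)"
  shows "a = b"
proof (rule ccontr)
  assume ab: "a \<noteq> b"
  define x y where "x = cyc_diff n a b" and "y = cyc_diff n b c"
  have x: "0 < x" "x < n" using ab cyc_diff_0[OF assms(1,2)] cyc_diff_less[OF assms(1,2)]
    unfolding x_def by auto
  have ba: "cyc_diff n b a = n - x" using cyc_diff_rev[OF assms(1,2)] x unfolding x_def by auto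
  have ac: "cyc_diff n a c = (if x + y < n then x + y else x + y - n)"
    using cyc_diff_add[OF assms(1-3)] unfolding x_def y_def Let_def .
  have D: "gap_pair n x y" "gap_pair n (n - x) (if x + y < n then x + y else x + y - n)"
    using assms(4,5) unfolding ba ac unfolding x_def y_def by auto
  show False
    using gap_pair_sum[OF D(1)] gap_pair_sum[OF D(2)] gap_pair_zero[of n x]
      gap_pair_zero[of n "n - x"] gap_pair_sym[OF D(1)] gap_pair_sym[OF D(2)] x
      by (auto split: if_splits)
qed

lemma no_window_swap_back:
  assumes "a<n" "b<n" "c<n" "gap_pair n (cyc_diff n a b) (cyc_diff n b c)"
    "gap_pair n (cyc_diff n a c) (cyc_diff n c b)"
  shows "b = c"
proof (rule ccontr)
  assume ab: "b \<noteq> c"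
  define x y where "x = cyc_diff n a b" and "y = cyc_diff n b c"
  have y: "0 < y" "y < n" using ab cyc_diff_0[OF assms(2,3)] cyc_diff_less[OF assms(2,3)]
    unfolding y_def by auto
  have cb: "cyc_diff n c b = n - y" using cyc_diff_rev[OF assms(2,3)] y unfolding y_def by auto
  have ac: "cyc_diff n a c = (if x + y < n then x + y else x + y - n)"
    using cyc_diff_add[OF assms(1-3)] unfolding x_def y_def Let_def .
  have D: "gap_pair n x y" "gap_pair n (if x + y < n then x + y else x + y - n) (n - y)"
    using assms(4,5) unfolding cb ac unfolding x_def y_def by auto
  show False
    using gap_pair_sum[OF D(1)] gap_pair_sum[OF D(2)] gap_pair_zero[of n y]
      gap_pair_zero[of n "n - y"] D y by (auto split: if_splits)
qed

lemma no_window_reverse: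
  assumes "a<n" "b<n" "c<n" "gap_pair n (cyc_diff n a b) (cyc_diff n b c)"
    "gap_pair n (cyc_diff n c b) (cyc_diff n b a)"
  shows "a = c"
proof (rule ccontr)
  assume ac: "a \<noteq> c"
  define x y where "x = cyc_diff n a b" and "y = cyc_diff n b c"
  have xy: "x < n" "y < n" using cyc_diff_less assms(1-3) unfolding x_def y_def by auto
  have r: "cyc_diff n b a = (if x = 0 then 0 else n - x)" "cyc_diff n c b = (if y = 0 then 0
    else n - y)"
    using cyc_diff_rev[OF assms(1,2)] cyc_diff_rev[OF assms(2,3)] unfolding x_def y_def by auto
  have "cyc_diff n a c = (if x + y < n then x + y else x + y - n)" using cyc_diff_add[OF assms(1-3)]
    unfolding x_def y_def Let_def .
  hence s: "x + y \<noteq> 0" "x + y \<noteq> n" using cyc_diff_0[OF assms(1,3)] ac by (auto split: if_splits)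
  have D: "gap_pair n x y" "gap_pair n (if y = 0 then 0 else n - y) (if x = 0 then 0 else n - x)"
    using assms(4,5) unfolding r unfolding x_def y_def by auto
  show False
    using gap_pair_sum[OF D(1)] gap_pair_sum[OF D(2)] gap_pair_zero[of n x] gap_pair_zero[of n y]
      gap_pair_zero[of n "n - x"] gap_pair_zero[of n "n - y"] D gap_pair_sym[OF D(1)]
      gap_pair_sym[OF D(2)] xy s by (auto split: if_splits)
qed

text \<open>
  Distinct gaps give only one pair, and two equal gaps exclude the third one unless it is equal
  as well. The last case is where divisibility by 3 enters.
\<close>
lemma gap_pair_unique:
  assumes xy: "x < n" "y < n" "x + y \<noteq> 0" "x + y < n"
    and d: "gap_pair n x y" "gap_pair n y (n - x - y)"
  shows "3 dvd n"
proof (rule ccontr)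
  assume 3: "\<not> 3 dvd n"
  obtain z where z: "n = x + y + z" using \<open>x + y < n\<close> by (metis less_imp_add_positive)
  have k: "n \<noteq> 3 * y" using 3 by auto
  have e: "n - x - y = z" using z by simp
  from d[unfolded e gap_pair_def joins_min_def] z k xy show False by (elim disjE conjE) linarith+
qed

lemma no_window_rotate:
  assumes "a<n" "b<n" "c<n" "\<not> 3 dvd n" "gap_pair n (cyc_diff n a b) (cyc_diff n b c)"
    "gap_pair n (cyc_diff n b c) (cyc_diff n c a)"
  shows "a = b \<and> b = c"
proof (rule ccontr)
  assume ac: "\<not> (a = b \<and> b = c)"
  define x y where "x = cyc_diff n a b" and "y = cyc_diff n b c"
  have xy: "x < n" "y < n" "x + y \<noteq> 0" using cyc_diff_less cyc_diff_0 assms(1-3) ac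
    unfolding x_def y_def by auto
  have "cyc_diff n a c = (if x + y < n then x + y else x + y - n)" using cyc_diff_add[OF assms(1-3)]
    unfolding x_def y_def Let_def .
  hence ca: "cyc_diff n c a = (if x + y < n then n - x - y else if x + y = n then 0
    else n - (x + y - n))"
    using cyc_diff_rev[OF assms(1,3)] xy by auto
  have D: "gap_pair n x y"
    "gap_pair n y (if x + y < n then n - x - y else if x + y = n then 0 else n - (x + y - n))"
    using assms(5,6) unfolding ca[symmetric] unfolding x_def y_def by auto
  show False
  proof (cases "x + y < n")
   case True
   then show ?thesis using D gap_pair_unique[of x n y] xy assms(4) by auto
  next
    case False
    then show ?thesis
      using gap_pair_sum[OF D(1)] D(2) xy gap_pair_zero[of n y] gap_pair_sym[OF D(2)] by auto
  qed
qed

lemma mset_triple_eq_imp_perm: "{#a, b, c#} = {#a', b', c'#}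
  \<Longrightarrow> (a',b',c') \<in> {(a,b,c),(a,c,b),(b,a,c),(b,c,a),(c,a,b),(c,b,a)}"
  by (auto simp: add_eq_conv_ex add_mset_eq_single single_eq_add_mset)

lemma inj_on_gap_windows:
  assumes "\<not> 3 dvd n"
  shows "inj_on (\<lambda>(a,b,c). {#a,b,c#}) (gap_windows n)"
proof (rule inj_onI)
  fix s t
  assume st: "s \<in> gap_windows n" "t \<in> gap_windows n" "(\<lambda>(a,b,c). {#a,b,c#}) s
    = (\<lambda>(a,b,c). {#a,b,c#}) t"
  obtain a b c a' b' c' where s: "s = (a,b,c)" and t: "t = (a',b',c')" by (metis prod_cases3)
  from st have T: "(a,b,c) \<in> gap_windows n" "(a',b',c') \<in> gap_windows n"
    and e: "{#a, b, c#} = {#a', b', c'#}" unfolding s t by auto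
  from T have l: "a<n" "b<n" "c<n" and d: "gap_pair n (cyc_diff n a b) (cyc_diff n b c)"
    "gap_pair n (cyc_diff n a' b') (cyc_diff n b' c')" unfolding gap_windows_def by auto
  note dd = no_window_swap_front[OF l d(1)] no_window_swap_back[OF l d(1)]
    no_window_reverse[OF l d(1)] no_window_rotate[OF l assms d(1)]
    no_window_rotate[OF l(3,1,2) assms _ d(1)]
  show "s = t" unfolding s t using mset_triple_eq_imp_perm[OF e] d(2) dd by auto
qed

lemma gap_windows_cover: assumes M: "size M = 3" "set_mset M \<subseteq> {..<n}"
  shows "M \<in> (\<lambda>(a,b,c). {#a,b,c#}) ` gap_windows n"
proof -
  obtain xs where xs: "mset xs = M" "sorted xs"
    by (metis mset_sorted_list_of_multiset sorted_sorted_list_of_multiset)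
  hence "length xs = 3" using M(1) by (metis size_mset)
  then obtain p q r where pqr: "xs = [p,q,r]" by (auto simp: length_Suc_conv numeral_3_eq_3)
  have le: "p \<le> q" "q \<le> r" and m: "M = {#p,q,r#}" using xs pqr by auto
  have l: "p < n" "q < n" "r < n" using M(2) m by auto
  show ?thesis
  proof (cases "p = r")
    case True
    then have "(p,q,r) \<in> gap_windows n" using le l
      unfolding gap_windows_def gap_pair_def cyc_diff_def by auto
    then show ?thesis using m by force
  next
    case False
    have e: "cyc_diff n p q = q - p" "cyc_diff n q r = r - q" "cyc_diff n r p = n + p - r"
      using le l False unfolding cyc_diff_def by auto
    have "gap_pair n (cyc_diff n p q) (cyc_diff n q r)
      \<or> gap_pair n (cyc_diff n q r) (cyc_diff n r p) \<or> gap_pair n (cyc_diff n r p) (cyc_diff n p q)"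
      using gap_pair_exists[of "q - p" "r - q" "n + p - r" n] l le unfolding e by auto
    then have "(p,q,r) \<in> gap_windows n \<or> (q,r,p) \<in> gap_windows n
      \<or> (r,p,q) \<in> gap_windows n" using l unfolding gap_windows_def by auto
    moreover have "{#p,q,r#} = {#q,r,p#}" "{#p,q,r#} = {#r,p,q#}" by auto
    ultimately show ?thesis using m by force
  qed
qed

definition cyc_add where "cyc_add n a x = (if a + x < n then a + x else a + x - (n::nat))"

lemma cyc_add_less: "a < n \<Longrightarrow> x < n \<Longrightarrow> cyc_add n a x < n" unfolding cyc_add_def by auto

lemma cyc_diff_plus: "a < n \<Longrightarrow> x < n \<Longrightarrow> cyc_diff n a (cyc_add n a x)
  = x" unfolding cyc_add_def cyc_diff_def by auto

lemma cyc_add_diff: "a < n \<Longrightarrow> b < n \<Longrightarrow> cyc_add n a (cyc_diff n a b)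
  = b" unfolding cyc_add_def cyc_diff_def by auto

definition cyc_sub where "cyc_sub n a x = (if x \<le> a then a - x else n + a - (x::nat))"

lemma cyc_sub_less: "a < n \<Longrightarrow> x < n \<Longrightarrow> cyc_sub n a x < n" unfolding cyc_sub_def by auto

lemma cyc_diff_minus: "a < n \<Longrightarrow> x < n \<Longrightarrow> cyc_diff n (cyc_sub n a x) a
  = x" unfolding cyc_sub_def cyc_diff_def by auto

lemma cyc_sub_diff: "a < n \<Longrightarrow> b < n \<Longrightarrow> cyc_sub n b (cyc_diff n a b)
  = a" unfolding cyc_sub_def cyc_diff_def by auto

text \<open>
  The arcs out of \<open>(a, b)\<close> are counted by the gaps that may follow the gap from \<open>a\<close> to \<open>b\<close>, the arcs into it by
  the gaps that may precede it. These agree by \<open>gap_pair_sym\<close>.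
\<close>
lemma gap_windows_balanced:
  assumes "a < n" "b < n"
  shows "card {c. (c,a,b) \<in> gap_windows n} = card {c. (a,b,c) \<in> gap_windows n}"
proof -
  let ?x = "cyc_diff n a b"
  have "bij_betw (\<lambda>c. cyc_diff n c a) {c. (c,a,b) \<in> gap_windows n} {y. y < n \<and> gap_pair n y ?x}"
    using assms by (intro bij_betw_byWitness[where f' = "cyc_sub n a"])
      (auto simp: gap_windows_def cyc_diff_less cyc_sub_less cyc_diff_minus cyc_sub_diff)
  moreover have "bij_betw (\<lambda>c. cyc_diff n b c) {c. (a,b,c) \<in> gap_windows n} {y. y < n
    \<and> gap_pair n ?x y}"
    using assms by (intro bij_betw_byWitness[where f' = "cyc_add n b"])
      (auto simp: gap_windows_def cyc_diff_less cyc_add_less cyc_diff_plus cyc_add_diff)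
  moreover have "{y. y < n \<and> gap_pair n ?x y} = {y. y < n \<and> gap_pair n y ?x}"
    using gap_pair_sym by blast
  ultimately show ?thesis by (simp add: bij_betw_same_card)
qed

section \<open>Eulerian circuits as window sequences\<close>

lemma cas_nth_tail:
  "pre_digraph.cas G u p v \<Longrightarrow> i < length p \<Longrightarrow>
    tail G (p ! i) = (if i = 0 then u else head G (p ! (i - 1)))"
proof (induction p arbitrary: u i)
  case (Cons e es)
  then show ?case by (cases i; cases "i - 1") (auto simp: pre_digraph.cas.simps)
qed simp

lemma cas_head_last:
  "pre_digraph.cas G u p v \<Longrightarrow> p \<noteq> [] \<Longrightarrow> head G (last p) = v"
  by (induction p arbitrary: u) (auto simp: pre_digraph.cas.simps)

lemma closed_trail_next:
  assumes "pre_digraph.cas G u p u" "i < length p"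
  shows "tail G (p ! ((i + 1) mod length p)) = head G (p ! i)"
proof (cases "i + 1 < length p")
  case True
  then show ?thesis using cas_nth_tail[OF assms(1) True] by simp
next
  case False
  with assms(2) have i: "i = length p - 1" "p \<noteq> []" by auto
  then show ?thesis using cas_nth_tail[OF assms(1), of 0] cas_head_last[OF assms(1)]
    by (simp add: last_conv_nth)
qed

text \<open>
  The arcs between adjacent pairs of letters, as in a de Bruijn graph.
\<close>
definition overlaps :: "('a \<times> 'a \<times> 'a) set \<Rightarrow> (('a \<times> 'a) \<times> ('a \<times> 'a)) set" where
  "overlaps A = {((a, b), (b, c)) | a b c. (a, b, c) \<in> A}"

text \<open>
  In an Eulerian circuit of the digraph of pairs, the first letters of the arcs spell a cyclic string whose
  windows are the arcs, because consecutive arcs overlap in two letters.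
\<close>
lemma eulerian_window_sequence:
  assumes fin: "finite A" and ne: "A \<noteq> {}"
    and bal: "\<And>a b. (a, b) \<in> Field (overlaps A) \<Longrightarrow> card {c. (c, a, b) \<in> A} = card {c. (a, b, c) \<in> A}"
    and con: "\<And>u. u \<in> Field (overlaps A) \<Longrightarrow> (u, r) \<in> (overlaps A \<union> (overlaps A)\<inverse>)\<^sup>*"
  obtains X where "bij_betw (\<lambda>i. (X ! i, X ! ((i + 1) mod length X), X ! ((i + 2) mod length X)))
    {..<length X} A"
    "set X \<subseteq> fst ` A"
proof -
  define G :: "('a \<times> 'a, 'a \<times> 'a \<times> 'a) pre_digraph" where
    "G = \<lparr>verts = Field (overlaps A), arcs = A, tail = (\<lambda>(a,b,c). (a,b)), head = (\<lambda>(a,b,c). (b,c))\<rparr>"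
  have G: "verts G = Field (overlaps A)" "arcs G = A" "\<And>a b c. tail G (a,b,c)
    = (a,b)" "\<And>a b c. head G (a,b,c) = (b,c)"
    unfolding G_def by auto
  have st: "(tail G e, head G e) \<in> overlaps A" if "e \<in> A" for e
    using that unfolding overlaps_def by (cases e) (auto simp: G)
  have "overlaps A = (\<lambda>e. (tail G e, head G e)) ` A" unfolding overlaps_def by (force simp: G)
  hence fs: "finite (overlaps A)" using fin by simp
  interpret fin_digraph G
    by unfold_locales (use st fin fs in \<open>auto simp: G(1,2) intro: FieldI1 FieldI2 finite_Field\<close>)
  have sym: "parcs (mk_symmetric G) = overlaps A \<union> (overlaps A)\<inverse>"
    unfolding parcs_mk_symmetric overlaps_def by (force simp: G)
  interpret S: pair_wf_digraph "mk_symmetric G" by rule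
  have reach: "u \<rightarrow>\<^sup>*\<^bsub>mk_symmetric G\<^esub> v"
    if "(u, v) \<in> (overlaps A \<union> (overlaps A)\<inverse>)\<^sup>*" "u \<in> verts G" for u v
    using that(1)
  proof (induction rule: rtrancl_induct)
    case base
    then show ?case using that(2) by (intro S.reachable_refl) auto
  next
    case (step y z)
    then show ?case using sym by (metis S.reachable_adj_trans with_proj_simps(3))
  qed
  have "connected G"
  proof -
    have "verts G \<noteq> {}" using ne st FieldI1 unfolding G(1) by (metis all_not_in_conv)
    moreover have "u \<rightarrow>\<^sup>*\<^bsub>mk_symmetric G\<^esub> v" if "u \<in> verts G" "v \<in> verts G" for u v
    proof -
      have "(u, r) \<in> (overlaps A \<union> (overlaps A)\<inverse>)\<^sup>*" "(v, r) \<in> (overlaps A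
        \<union> (overlaps A)\<inverse>)\<^sup>*" using con that unfolding G(1) by auto
      moreover have "sym ((overlaps A \<union> (overlaps A)\<inverse>)\<^sup>*)" by (intro sym_rtrancl sym_Un_converse)
      ultimately show ?thesis using reach that(1) by (meson rtrancl_trans symD)
    qed
    ultimately show ?thesis unfolding connected_def strongly_connected_def by simp
  qed
  moreover have "in_degree G u = out_degree G u" if u: "u \<in> verts G" for u
  proof -
    obtain a b where ab: "u = (a,b)" by (cases u)
    have "in_arcs G u = (\<lambda>c. (c,a,b)) ` {c. (c,a,b) \<in> A}" "out_arcs G u
      = (\<lambda>c. (a,b,c)) ` {c. (a,b,c) \<in> A}"
      unfolding in_arcs_def out_arcs_def ab by (auto simp: G)
    then show ?thesis using bal[of a b] u unfolding in_degree_def out_degree_def G(1) ab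
      by (simp add: card_image inj_on_def)
  qed
  ultimately obtain u p where "euler_trail u p u" using closed_euler1 by blast
  hence p: "cas u p u" "distinct p" "set p = A" unfolding euler_trail_def trail_def awalk_def
    by (auto simp: G)
  define X where "X = map fst p"
  have len: "length X = length p" unfolding X_def by simp
  have win: "(X ! i, X ! ((i + 1) mod length X), X ! ((i + 2) mod length X)) = p ! i"
    if i: "i < length p" for i
  proof -
    let ?k = "length p"
    have k: "?k > 0" using i by linarith
    obtain a b c where e: "p ! i = (a,b,c)" by (metis prod_cases3)
    obtain a' b' c' where e': "p ! ((i + 1) mod ?k) = (a',b',c')" by (metis prod_cases3)
    obtain a'' b'' c'' where e'': "p ! ((i + 2) mod ?k) = (a'',b'',c'')" by (metis prod_cases3)
    have "(a',b') = (b,c)" using closed_trail_next[OF p(1) i]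
      by (simp add: e[simplified] e'[simplified] G)
    moreover have "((i + 1) mod ?k + 1) mod ?k = (i + 2) mod ?k" by (simp add: mod_simps)
    hence "(a'',b'') = (b',c')" using closed_trail_next[OF p(1), of "(i + 1) mod ?k"] k
      by (simp add: e'[simplified] e''[simplified] G)
    ultimately show ?thesis using e e' e'' i k unfolding len by (simp add: X_def)
  qed
  have "bij_betw ((!) p) {..<length p} A" using bij_betw_nth[OF p(2)] p(3) by simp
  hence "bij_betw (\<lambda>i. (X ! i, X ! ((i + 1) mod length X), X ! ((i + 2) mod length X)))
    {..<length X} A"
    by (subst bij_betw_cong[where g = "(!) p"]) (use win in \<open>auto simp: len\<close>)
  moreover have "set X \<subseteq> fst ` A" unfolding X_def using p(3) by auto
  ultimately show thesis by (rule that)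
qed

section \<open>Connectedness\<close>

lemma gap_windows_cyc_add: "a < n \<Longrightarrow> x < n \<Longrightarrow> y < n \<Longrightarrow> gap_pair n x y \<Longrightarrow>
   (a, cyc_add n a x, cyc_add n (cyc_add n a x) y) \<in> gap_windows n"
  unfolding gap_windows_def by (simp add: cyc_add_less cyc_diff_plus)

lemma gap_windows_connected:
  assumes n: "n \<ge> 5" and u: "u \<in> Field (overlaps (gap_windows n))"
  shows "(u, (0, 1)) \<in> (overlaps (gap_windows n) \<union> (overlaps (gap_windows n))\<inverse>)\<^sup>*"
proof -
  let ?S = "overlaps (gap_windows n) \<union> (overlaps (gap_windows n))\<inverse>"
  let ?P = "\<lambda>a x. (a, cyc_add n a x)"
  let ?good = "\<lambda>u. (u, (0, 1)) \<in> ?S\<^sup>*"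
  have st: "(?P a x, ?P (cyc_add n a x) y) \<in> overlaps (gap_windows n)"
    if "a < n" "x < n" "y < n" "gap_pair n x y" for a x y
    using gap_windows_cyc_add[OF that] unfolding overlaps_def by blast
  have fw: "?good (?P a x)" if "a < n" "x < n" "y < n"
    "gap_pair n x y" "?good (?P (cyc_add n a x) y)" for a x y
    using st[OF that(1-4)] that(5) by (meson UnI1 converse_rtrancl_into_rtrancl)
  have bw: "?good (?P (cyc_add n a x) y)" if "a < n" "x < n" "y < n"
    "gap_pair n x y" "?good (?P a x)" for a x y
    using st[OF that(1-4)] that(5) by (meson UnI2 converseI converse_rtrancl_into_rtrancl)
  \<comment> \<open>the pair of gaps 1, 1 moves (a, a + 1) to (a + 1, a + 2)\<close>
  have one: "?good (?P a 1)" if "a < n" for a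
    using that
  proof (induction a)
    case 0
    then show ?case using n by (simp add: cyc_add_def)
  next
    case (Suc a)
    then have "cyc_add n a 1 = Suc a" by (simp add: cyc_add_def)
    then show ?case using bw[of a 1 1] Suc n by (simp add: gap_pair_def)
  qed
  have zero: "?good (?P a 0)" if "a < n" for a
    using fw[of a 0 1] one[of a] that n by (simp add: gap_pair_def joins_min_def cyc_add_def)
  have small: "?good (?P a y)" if "a < n" "2 * y < n" for a y
  proof (cases "y = 0")
    case False
    then show ?thesis using bw[of a 0 y] zero[of a] that
      by (simp add: gap_pair_def joins_min_def cyc_add_def)
  qed (use zero that in simp)
  have large: "?good (?P a y)" if "a < n" "y < n" "2 * w < n" "gap_pair n w y" for a y w
  proof -
    define c where "c = cyc_sub n a w"
    have "c < n" "cyc_add n c w = a" using that unfolding c_def cyc_sub_def cyc_add_def by auto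
    then show ?thesis using bw[of c w y] small[of c w] that by auto
  qed
  obtain a b where ab: "u = (a, b)" by (cases u)
  have l: "a < n" "b < n" using u unfolding ab Field_def overlaps_def gap_windows_def by auto
  define x where "x = cyc_diff n a b"
  have P: "u = ?P a x" "x < n" unfolding ab x_def using cyc_add_diff[OF l] cyc_diff_less[OF l]
    by auto
  obtain y where D: "gap_pair n x y"
    using u unfolding ab Field_def overlaps_def gap_windows_def x_def by (auto dest: gap_pair_sym)
  consider "2 * x < n" | "2 * x = n" | "n < 2 * x" by linarith
  then show ?thesis
  proof cases
    case 1
    then show ?thesis using small[of a x] l P by simp
  next
    case 2
    \<comment> \<open>the gaps 1, x - 1, x are distinct because n is at least 5\<close>
    then have "gap_pair n 1 x" using n unfolding gap_pair_def joins_min_def by auto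
    then show ?thesis using large[of a x 1] n l P by simp
  next
    case 3
    \<comment> \<open>a gap above n/2 is only ever chosen as the larger partner\<close>
    then have "2 * y < n" using D unfolding gap_pair_def joins_min_def by auto
    then show ?thesis using large[of a x y] gap_pair_sym[OF D] l P by simp
  qed
qed

section \<open>Universal cycles as bijections\<close>

lemma multisets3_altdef: "multisets3 n = multisets_of_size {1..n} 3"
  unfolding multisets3_def multisets_of_size_def by auto

lemma card_multisets3: "card (multisets3 n) = (n + 2) choose 3"
  unfolding multisets3_altdef by (simp add: card_multisets_of_size)

lemma finite_multisets3: "finite (multisets3 n)"
  unfolding multisets3_altdef by (simp add: finite_multisets_of_size)

lemma window3_in_multisets3:
  assumes "set X \<subseteq> {1..n}" "i < length X"
  shows "window3 X i \<in> multisets3 n"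
proof -
  have "X ! (j mod length X) \<in> {1..n}" for j
    using assms by (intro subsetD[OF assms(1)] nth_mem mod_less_divisor) linarith
  then show ?thesis unfolding window3_def multisets3_def by auto
qed

lemma universal_cycle3_iff:
  "universal_cycle3 n X \<longleftrightarrow> set X \<subseteq> {1..n} \<and> bij_betw (window3 X) {..<length X} (multisets3 n)"
proof (cases "set X \<subseteq> {1..n}")
  case True
  have in_ms: "window3 X i \<in> multisets3 n" if "i < length X" for i
    using window3_in_multisets3[OF True that] .
  show ?thesis
  proof
    assume u: "universal_cycle3 n X"
    then have "inj_on (window3 X) {..<length X}"
      using in_ms unfolding universal_cycle3_def inj_on_def by blast
    moreover have "window3 X ` {..<length X} = multisets3 n"
      using in_ms u unfolding universal_cycle3_def by blast
    ultimately show "set X \<subseteq> {1..n} \<and> bij_betw (window3 X) {..<length X} (multisets3 n)"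
      using True unfolding bij_betw_def by simp
  next
    assume *: "set X \<subseteq> {1..n} \<and> bij_betw (window3 X) {..<length X} (multisets3 n)"
    have "\<exists>!i. i < length X \<and> window3 X i = M" if "M \<in> multisets3 n" for M
    proof -
      have "M \<in> window3 X ` {..<length X}" using * that by (simp add: bij_betw_def)
      then obtain i where i: "i < length X" "window3 X i = M" by auto
      have "inj_on (window3 X) {..<length X}" using * unfolding bij_betw_def by blast
      then have "j = i" if "j < length X" "window3 X j = M" for j
        using i that by (auto dest: inj_onD)
      then show ?thesis using i by blast
    qed
    then show "universal_cycle3 n X" using True unfolding universal_cycle3_def by blast
  qed
qed (simp add: universal_cycle3_def)

section \<open>Existence\<close>

lemma universal_cycle3_exists:
  assumes n: "n \<ge> 5" "\<not> 3 dvd n"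
  shows "\<exists>X. universal_cycle3 n X"
proof -
  have fin: "finite (gap_windows n)"
    by (rule finite_subset[of _ "{..<n} \<times> {..<n} \<times> {..<n}"]) (auto simp: gap_windows_def)
  have ne: "gap_windows n \<noteq> {}" using n
    by (auto simp: gap_windows_def gap_pair_def cyc_diff_def intro!: exI[of _ 0])
  have bal: "card {c. (c, a, b) \<in> gap_windows n} = card {c. (a, b, c) \<in> gap_windows n}"
    if "(a,b) \<in> Field (overlaps (gap_windows n))" for a b
    using that by (intro gap_windows_balanced) (auto simp: Field_def overlaps_def gap_windows_def)
  obtain X where X: "bij_betw (\<lambda>i. (X ! i, X ! ((i + 1) mod length X), X ! ((i + 2) mod length X)))
      {..<length X} (gap_windows n)"
    "set X \<subseteq> fst ` gap_windows n"
    using eulerian_window_sequence[OF fin ne bal gap_windows_connected[OF n(1)]] .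
  have "bij_betw (\<lambda>(a,b,c). {#Suc a, Suc b, Suc c#}) (gap_windows n) (multisets3 n)"
  proof -
    have "inj_on (\<lambda>(a,b,c). {#Suc a, Suc b, Suc c#}) (gap_windows n)"
    proof -
      have "(\<lambda>(a,b,c). {#Suc a, Suc b, Suc c#}) = image_mset Suc \<circ> (\<lambda>(a,b,c). {#a,b,c#})" by auto
      moreover have "inj (image_mset Suc)" by (simp add: multiset.inj_map)
      ultimately show ?thesis
        using comp_inj_on[OF inj_on_gap_windows[OF n(2)] inj_on_subset[OF _ subset_UNIV]] by simp
    qed
    moreover have "M \<in> (\<lambda>(a,b,c). {#Suc a, Suc b, Suc c#}) ` gap_windows n"
      if M: "M \<in> multisets3 n" for M
    proof -
      have "image_mset (\<lambda>x. x - 1) M \<in> (\<lambda>(a,b,c). {#a,b,c#}) ` gap_windows n"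
        using M by (intro gap_windows_cover) (fastforce simp: multisets3_def)+
      then obtain a b c where abc: "(a,b,c) \<in> gap_windows n" "image_mset (\<lambda>x. x - 1) M
        = {#a,b,c#}" by auto
      have "Suc (x - 1) = x" if "x \<in># M" for x using M that by (force simp: multisets3_def)
      then have "image_mset (\<lambda>x. Suc (x - 1)) M = image_mset (\<lambda>x. x) M" by (rule image_mset_cong)
      then have "M = image_mset Suc (image_mset (\<lambda>x. x - 1) M)"
        by (simp add: multiset.map_comp o_def)
      then show ?thesis using abc by force
    qed
    moreover have "(\<lambda>(a,b,c). {#Suc a, Suc b, Suc c#}) ` gap_windows n \<subseteq> multisets3 n"
      by (auto simp: gap_windows_def multisets3_def)
    ultimately show ?thesis unfolding bij_betw_def by blast
  qed
  from bij_betw_trans[OF X(1) this]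
  have "bij_betw (window3 (map Suc X)) {..<length X} (multisets3 n)"
  proof (rule bij_betw_cong[THEN iffD1, rotated])
    fix i assume "i \<in> {..<length X}"
    then have "0 < length X" by auto
    then show "((\<lambda>(a,b,c). {#Suc a, Suc b, Suc c#}) \<circ>
        (\<lambda>i. (X ! i, X ! ((i + 1) mod length X), X ! ((i + 2) mod length X)))) i
          = window3 (map Suc X) i"
      using \<open>i \<in> {..<length X}\<close> by (simp add: window3_def)
  qed
  moreover have "set (map Suc X) \<subseteq> {1..n}" using X(2) by (fastforce simp: gap_windows_def)
  ultimately show ?thesis unfolding universal_cycle3_iff by (intro exI[of _ "map Suc X"]) simp
qed

text \<open>
  For \<open>n = 4\<close> the gaps \<open>2, 2\<close> are linked to no other gap, since the gaps 1, 1, 2 are not distinct. The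
  20 windows of the cycle below are distinct, which suffices, as there are 20 multisets.
\<close>
lemma universal_cycle3_4: "\<exists>X. universal_cycle3 4 X"
proof -
  let ?X = "[1, 1, 1, 2, 2, 2, 3, 1, 3, 1, 4, 2, 4, 2, 3, 3, 3, 4, 4, 4] :: nat list"
  \<comment> \<open>sorted lists make the comparison of multisets computable by rewriting\<close>
  have w: "sorted_list_of_multiset (window3 ?X i)
    = sort [?X ! (i mod 20), ?X ! ((i + 1) mod 20), ?X ! ((i + 2) mod 20)]" for i
    unfolding window3_def by (simp flip: sorted_list_of_multiset_mset)
  have "distinct (map (\<lambda>i. sort [?X ! (i mod 20), ?X ! ((i + 1) mod 20), ?X ! ((i + 2) mod 20)]) [0..<20])"
    by code_simp
  hence "inj_on (\<lambda>i. sorted_list_of_multiset (window3 ?X i)) {..<20}"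
    unfolding w distinct_map by (simp add: atLeast0LessThan)
  hence inj: "inj_on (window3 ?X) {..<20}" by (auto simp: inj_on_def)
  have s: "set ?X \<subseteq> {1..4}" by simp
  have "card (window3 ?X ` {..<20}) = card (multisets3 4)"
    using card_image[OF inj] by (simp add: card_multisets3 numeral_eq_Suc)
  moreover have "window3 ?X ` {..<20} \<subseteq> multisets3 4" using window3_in_multisets3[OF s] by auto
  ultimately have "window3 ?X ` {..<20} = multisets3 4" using card_subset_eq[OF finite_multisets3]
    by blast
  then show ?thesis using inj s unfolding universal_cycle3_iff bij_betw_def
    by (intro exI[of _ ?X]) (simp add: numeral_eq_Suc)
qed

section \<open>Necessity\<close>

lemma sum_rotate: "(\<Sum>i<k. f ((i + 1) mod k)) = (\<Sum>i<k. f i :: 'a :: comm_monoid_add)" for k :: nat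
proof (cases k)
  case (Suc m)
  have "(\<Sum>i<Suc m. f ((i + 1) mod Suc m)) = (\<Sum>i<m. f (Suc i)) + f 0" by simp
  also have "\<dots> = (\<Sum>i<Suc m. f i)"
    by (simp add: sum.lessThan_Suc_shift add.commute del: sum.lessThan_Suc)
  finally show ?thesis using Suc by simp
qed simp

text \<open>
  Exchanging two letters permutes the 3-multisets, so the total multiplicity of a letter in all of them does
  not depend on the letter. In a universal cycle it is three times the number of occurrences.
\<close>
lemma universal_cycle3_imp_dvd:
  assumes "universal_cycle3 n X"
  shows "n dvd ((n + 2) choose 3)"
proof (cases "n = 0")
  case False
  from assms have b: "bij_betw (window3 X) {..<length X} (multisets3 n)"
    unfolding universal_cycle3_iff by auto
  define occ where "occ x = (\<Sum>i<length X. if X ! i = x then 1 else 0 :: nat)" for x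
  have occ: "(\<Sum>M\<in>multisets3 n. count M x) = 3 * occ x" for x
  proof -
    let ?k = "length X"
    let ?f = "\<lambda>i. if X ! i = x then 1 else 0 :: nat"
    have "(\<Sum>M\<in>multisets3 n. count M x) = (\<Sum>i<?k. count (window3 X i) x)"
      by (rule sum.reindex_bij_betw[OF b, symmetric])
    also have "\<dots> = (\<Sum>i<?k. ?f i + ?f ((i + 1) mod ?k) + ?f ((i + 2) mod ?k))"
      by (rule sum.cong) (auto simp: window3_def)
    also have "\<dots> = occ x + occ x + (\<Sum>i<?k. ?f ((i + 2) mod ?k))"
      unfolding occ_def sum.distrib using sum_rotate[of ?f ?k] by presburger
    also have "(\<Sum>i<?k. ?f ((i + 2) mod ?k)) = (\<Sum>i<?k. ?f (((i + 1) mod ?k + 1) mod ?k))"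
      by (simp add: mod_simps)
    also have "\<dots> = occ x"
      unfolding occ_def
        using sum_rotate[of "\<lambda>i. ?f ((i + 1) mod ?k)" ?k] sum_rotate[of ?f ?k] by metis
    finally show ?thesis by simp
  qed
  have symm: "(\<Sum>M\<in>multisets3 n. count M x) = (\<Sum>M\<in>multisets3 n. count M 1)" if x: "x \<in> {1..n}" for x
  proof -
    let ?t = "Transposition.transpose 1 x"
    have t: "?t y \<in> {1..n}" if "y \<in> {1..n}" for y using that x False by (auto simp: transpose_def)
    have ii: "image_mset ?t (image_mset ?t M) = M" for M by (simp add: multiset.map_comp)
    have cl: "image_mset ?t M \<in> multisets3 n" if "M \<in> multisets3 n" for M
      using that t unfolding multisets3_def by auto
    have "count (image_mset ?t M) 1 = count M x" for M
      by (induction M) (auto simp: transpose_def)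
    then show ?thesis
      by (intro sum.reindex_bij_witness[of _ "image_mset ?t" "image_mset ?t"])
        (simp_all only: ii cl)
  qed
  have "3 * card (multisets3 n) = (\<Sum>M\<in>multisets3 n. size M)" by (simp add: multisets3_def)
  also have "\<dots> = (\<Sum>M\<in>multisets3 n. \<Sum>x\<in>{1..n}. count M x)"
  proof (rule sum.cong)
    fix M assume "M \<in> multisets3 n"
    then have "set_mset M \<subseteq> {1..n}" unfolding multisets3_def by blast
    then show "size M = (\<Sum>x\<in>{1..n}. count M x)"
      unfolding size_multiset_overloaded_eq by (intro sum.mono_neutral_left) (auto simp: not_in_iff)
  qed simp
  also have "\<dots> = (\<Sum>x\<in>{1..n}. \<Sum>M\<in>multisets3 n. count M x)" by (rule sum.swap)
  also have "\<dots> = (\<Sum>x\<in>{1..n}. 3 * occ 1)"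
  proof (rule sum.cong)
    fix x assume "x \<in> {1..n}"
    then show "(\<Sum>M\<in>multisets3 n. count M x) = 3 * occ 1" using symm[of x] occ[of 1] by argo
  qed simp
  also have "\<dots> = 3 * (n * occ 1)" by simp
  finally have "card (multisets3 n) = n * occ 1" by simp
  then show ?thesis unfolding card_multisets3 by simp
next
  case True
  then show ?thesis by simp
qed

text \<open>
  The quotient is \<open>(n + 1) (n + 2) / 6\<close>, and for \<open>n\<close> divisible by 3 the numerator is 2 modulo 3.
\<close>
lemma dvd_choose_imp_not_3_dvd:
  assumes "n > 0" "n dvd ((n + 2) choose 3)"
  shows "\<not> 3 dvd n"
proof
  assume "3 dvd n"
  then obtain m where m: "n = 3 * m" by auto
  from assms(2) obtain q where q: "(n + 2) choose 3 = n * q" by auto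
  have "3 * ((n + 2) choose 3) = (n + 2) * ((n + 1) choose 2)"
    using Suc_times_binomial[of 2 "Suc n"] by (simp add: numeral_3_eq_3 del: binomial_Suc_Suc)
  moreover have "2 * ((n + 1) choose 2) = (n + 1) * n"
    using Suc_times_binomial[of 1 n] by (simp add: numeral_2_eq_2 del: binomial_Suc_Suc)
  ultimately have "(n + 2) * ((n + 1) * n) = 2 * (3 * ((n + 2) choose 3))" by simp
  then have "n * (6 * q) = n * ((n + 2) * (n + 1))" unfolding q by (simp add: algebra_simps)
  then have "6 * q = (n + 2) * (n + 1)" by (simp only: nat_mult_eq_cancel1[OF assms(1)])
  then have "6 * q = 3 * (3 * m * m + 3 * m) + 2" unfolding m by (simp add: algebra_simps)
  then show False by presburger
qed

theorem mainTheorem1: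
  fixes n :: nat
  assumes "n \<ge> 4"
  shows "(\<exists>X. universal_cycle3 n X) \<longleftrightarrow> n dvd ((n + 2) choose 3)"
proof
  assume "n dvd ((n + 2) choose 3)"
  with assms have "\<not> 3 dvd n" by (intro dvd_choose_imp_not_3_dvd) auto
  then show "\<exists>X. universal_cycle3 n X"
    using universal_cycle3_4 universal_cycle3_exists[of n] assms by (cases "n = 4") auto
qed (auto dest: universal_cycle3_imp_dvd)

end
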